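(* Let $c\ge 1$ and $n\ge 1$ be integers and let $a\in\{1,\dots,c\}$. Then $$\left|\Pi_n^{eq}\wr C_c(1^a2^a)\right|=B(n)(c-1)^n+\sum_{i=1}^n\sum_{j=0}^{n-i}\binom{n}{i}\binom{n-i}{j}B(n-i-j)(c-1)^{n-i}.$$
   Context: $\Pi_n\wr C_c$ denotes the set of colored set partitions of $[n]$: pairs consisting of a set partition of $[n]$ and an assignment of a color in $\{1,\dots,c\}$ to each element. A colored partition eq-contains $1^a2^a$ if there are elements $x<y$ lying in different blocks, both colored $a$; otherwise it eq-avoids $1^a2^a$. $\Pi_n^{eq}\wr C_c(1^a2^a)$ is the set of elements of $\Pi_n\wr C_c$ eq-avoiding $1^a2^a$. $B(m)$ is the $m$-th Bell number, $B(0)=1$. *)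

theory Defs
  imports "HOL-Library.Disjoint_Sets" "HOL-Library.FuncSet"
begin

definition Bell :: "nat \<Rightarrow> nat" where
  "Bell m = card {P. partition_on {1..m} P}"

text \<open>A coloring of \<open>{1..n}\<close> is an extensional function, so that colorings which agree on
  \<open>{1..n}\<close> are counted once.\<close>

definition colored_partitions :: "nat \<Rightarrow> nat \<Rightarrow> (nat set set \<times> (nat \<Rightarrow> nat)) set" where
  "colored_partitions n c = {P. partition_on {1..n} P} \<times> ({1..n} \<rightarrow>\<^sub>E {1..c})"

definition eq_contains_12 :: "nat \<Rightarrow> nat set set \<times> (nat \<Rightarrow> nat) \<Rightarrow> bool" where
  "eq_contains_12 a \<pi> \<longleftrightarrow>
    (\<exists>X\<in>fst \<pi>. \<exists>Y\<in>fst \<pi>. \<exists>x\<in>X. \<exists>y\<in>Y. X \<noteq> Y \<and> x < y \<and> snd \<pi> x = a \<and> snd \<pi> y = a)"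

definition eq_avoiders_12 :: "nat \<Rightarrow> nat \<Rightarrow> nat \<Rightarrow> (nat set set \<times> (nat \<Rightarrow> nat)) set" where
  "eq_avoiders_12 n c a = {\<pi> \<in> colored_partitions n c. \<not> eq_contains_12 a \<pi>}"

end

theory Submission
  imports Defs
begin

text \<open>Group the avoiders by the set \<open>S\<close> of elements colored \<open>a\<close>. Avoidance means that
  \<open>S\<close> is empty or lies inside a single block. If \<open>S\<close> is nonempty, that block is \<open>S \<union> T\<close> for a
  unique \<open>T\<close> disjoint from \<open>S\<close>, and the remaining blocks form an arbitrary partition of the
  complement of \<open>S \<union> T\<close>; the elements outside \<open>S\<close> take any of the other \<open>c - 1\<close> colors. The
  indices \<open>i\<close> and \<open>j\<close> of the formula are the cardinalities of \<open>S\<close> and \<open>T\<close>.\<close>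

lemma finite_partitions_on: "finite A \<Longrightarrow> finite {P. partition_on A P}"
  by (rule finite_subset[of _ "Pow (Pow A)"]) (auto simp: partition_on_def)

lemma partition_on_image_image:
  assumes "partition_on A P" "inj_on h A"
  shows "partition_on (h ` A) ((`) h ` P)"
proof (rule partition_onI)
  show "\<Union>((`) h ` P) = h ` A"
    using assms(1) by (auto simp: partition_on_def)
next
  fix p q assume pq: "p \<in> (`) h ` P" "q \<in> (`) h ` P" "p \<noteq> q"
  then obtain X Y where XY: "X \<in> P" "Y \<in> P" "p = h ` X" "q = h ` Y" "X \<noteq> Y" by blast
  moreover have "X \<inter> Y = {}" "X \<subseteq> A" "Y \<subseteq> A"
    using XY assms(1) by (auto simp: partition_on_def disjoint_def)
  ultimately show "disjnt p q"
    using inj_on_image_Int[OF assms(2), of X Y] by (simp add: disjnt_def)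
qed (use assms(1) in \<open>auto simp: partition_on_def\<close>)

text \<open>Taking images under \<open>h\<close> twice, of blocks and then of families of blocks,
  stays injective. An inequality is enough, since equality follows by applying it to
  \<open>h\<close> and to its inverse.\<close>

lemma card_partitions_on_le:
  assumes "finite B" "bij_betw h A B"
  shows "card {P. partition_on A P} \<le> card {P. partition_on B P}"
proof (rule card_inj_on_le)
  have h: "inj_on h A" "h ` A = B" using assms by (auto simp: bij_betw_def)
  have "inj_on ((`) ((`) h)) (Pow (Pow A))"
    using h(1) by (intro inj_on_image_Pow)
  then show "inj_on ((`) ((`) h)) {P. partition_on A P}"
    by (rule inj_on_subset) (auto simp: partition_on_def)
  show "(`) ((`) h) ` {P. partition_on A P} \<subseteq> {P. partition_on B P}"
    using partition_on_image_image[OF _ h(1)] h(2) by auto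
qed (rule finite_partitions_on[OF assms(1)])

lemma card_partitions_on:
  assumes "finite (A :: 'a set)"
  shows "card {P. partition_on A P} = Bell (card A)"
proof -
  obtain h :: "'a \<Rightarrow> nat" where h: "bij_betw h A {1..card A}"
    using ex_bij_betw_finite_nat[OF assms] finite_same_card_bij[OF assms, of "{1..card A}"]
    by auto
  show ?thesis
    unfolding Bell_def
    using card_partitions_on_le[OF _ h] card_partitions_on_le[OF assms bij_betw_inv_into[OF h]]
    by simp
qed

text \<open>Deleting the block \<open>X\<close> leaves an arbitrary partition of
  \<open>A - X\<close>, and inserting \<open>X\<close> undoes this.\<close>

lemma card_partitions_with_block:
  assumes "finite A" "X \<subseteq> A" "X \<noteq> {}"
  shows "card {P. partition_on A P \<and> X \<in> P} = Bell (card A - card X)"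
proof -
  have "bij_betw (insert X) {P. partition_on (A - X) P} {P. partition_on A P \<and> X \<in> P}"
  proof (rule bij_betw_byWitness[where f' = "\<lambda>P. P - {X}"])
    \<comment> \<open>A block of a partition of \<open>A - X\<close> misses the nonempty set
      \<open>X\<close>, so \<open>X\<close> is not already in \<open>P\<close> and removing it
      restores \<open>P\<close>.\<close>
    show "\<forall>P\<in>{P. partition_on (A - X) P}. insert X P - {X} = P"
      using assms(3) by (force simp: partition_on_def)
    show "insert X ` {P. partition_on (A - X) P} \<subseteq> {P. partition_on A P \<and> X \<in> P}"
    proof clarify
      fix P assume P: "partition_on (A - X) P"
      then have "disjoint P" "\<Union>P = A - X" "{} \<notin> P" by (auto simp: partition_on_def)
      moreover from this have "\<And>Y. Y \<in> P \<Longrightarrow> Y \<inter> X = {}" by blast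
      ultimately show "partition_on A (insert X P) \<and> X \<in> insert X P"
        using assms(2,3) by (auto simp: partition_on_def disjoint_def)
    qed
    show "(\<lambda>P. P - {X}) ` {P. partition_on A P \<and> X \<in> P} \<subseteq> {P. partition_on (A - X) P}"
    proof clarify
      fix P assume P: "partition_on A P" "X \<in> P"
      then have d: "disjoint P" "\<Union>P = A" "{} \<notin> P" by (auto simp: partition_on_def)
      then have "\<And>Y. Y \<in> P - {X} \<Longrightarrow> Y \<inter> X = {}"
        using P(2) by (auto simp: disjoint_def)
      then have "\<Union>(P - {X}) = A - X" using d(2) by blast
      then show "partition_on (A - X) (P - {X})"
        using d by (auto simp: partition_on_def disjoint_def)
    qed
  qed auto
  from bij_betw_same_card[OF this] show ?thesis
    using assms finite_subset[OF assms(2,1)] card_partitions_on[of "A - X"]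
    by (simp add: card_Diff_subset)
qed

text \<open>Grouping subsets by size produces both binomial coefficients of the formula: the inner
  one from the sets \<open>T\<close>, the outer one from the sets \<open>S\<close>.\<close>

lemma sum_card_Pow:
  fixes f :: "nat \<Rightarrow> nat"
  assumes "finite A"
  shows "(\<Sum>S\<in>Pow A. f (card S)) = (\<Sum>j=0..card A. (card A choose j) * f j)"
proof -
  have "(\<Sum>S\<in>Pow A. f (card S)) = (\<Sum>j=0..card A. \<Sum>S\<in>{S \<in> Pow A. card S = j}. f (card S))"
    by (rule sum.group[symmetric]) (use assms in \<open>auto intro: card_mono\<close>)
  also have "\<dots> = (\<Sum>j=0..card A. (card A choose j) * f j)"
    using n_subsets[OF assms] by (intro sum.cong) auto
  finally show ?thesis .
qed

text \<open>Classify the partitions by the part \<open>T\<close> of the block around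
  \<open>S\<close> that lies outside \<open>S\<close>. Each class prescribes the single block
  \<open>S \<union> T\<close>, which leaves a partition of the other elements.\<close>

lemma card_partitions_subset_block:
  assumes "finite A" "S \<subseteq> A" "S \<noteq> {}"
  shows "card {P. partition_on A P \<and> (\<exists>X\<in>P. S \<subseteq> X)} =
    (\<Sum>j=0..card A - card S. ((card A - card S) choose j) * Bell (card A - card S - j))"
proof -
  have fS: "finite S" using assms finite_subset by blast
  define F where "F T = {P. partition_on A P \<and> S \<union> T \<in> P}" for T
  have "{P. partition_on A P \<and> (\<exists>X\<in>P. S \<subseteq> X)} = (\<Union>T\<in>Pow (A - S). F T)"
  proof (intro equalityI subsetI)
    fix P assume "P \<in> {P. partition_on A P \<and> (\<exists>X\<in>P. S \<subseteq> X)}"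
    then obtain X where X: "partition_on A P" "X \<in> P" "S \<subseteq> X" by blast
    then have "X - S \<in> Pow (A - S)" "S \<union> (X - S) = X" by (auto simp: partition_on_def)
    moreover from this X have "P \<in> F (X - S)" by (simp only: F_def mem_Collect_eq simp_thms)
    ultimately show "P \<in> (\<Union>T\<in>Pow (A - S). F T)" by blast
  qed (auto simp: F_def)
  also have "card \<dots> = (\<Sum>T\<in>Pow (A - S). card (F T))"
  proof (rule card_UN_disjoint)
    show "\<forall>T\<in>Pow (A - S). finite (F T)"
      using finite_partitions_on[OF assms(1)] by (auto simp: F_def intro: finite_subset)
    show "\<forall>T\<in>Pow (A - S). \<forall>U\<in>Pow (A - S). T \<noteq> U \<longrightarrow> F T \<inter> F U = {}"
    proof (intro ballI impI)
      fix T U assume TU: "T \<in> Pow (A - S)" "U \<in> Pow (A - S)" "T \<noteq> U"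
      then have "S \<union> T \<noteq> S \<union> U" by blast
      \<comment> \<open>Two different blocks cannot share the elements of \<open>S\<close>; this is
        where nonemptiness makes \<open>T\<close> unique.\<close>
      moreover have "(S \<union> T) \<inter> (S \<union> U) \<noteq> {}" using assms(3) by blast
      ultimately have "\<not> (partition_on A P \<and> S \<union> T \<in> P \<and> S \<union> U \<in> P)" for P
        by (metis partition_onD2 disjointD)
      then show "F T \<inter> F U = {}" by (auto simp: F_def)
    qed
  qed (use assms(1) in auto)
  also have "\<dots> = (\<Sum>T\<in>Pow (A - S). Bell (card A - card S - card T))"
  proof (rule sum.cong)
    fix T assume T: "T \<in> Pow (A - S)"
    then have "card (S \<union> T) = card S + card T"
      using fS assms(1) by (intro card_Un_disjoint) (auto intro: finite_subset)
    then show "card (F T) = Bell (card A - card S - card T)"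
      using card_partitions_with_block[OF assms(1), of "S \<union> T"] T assms(2,3)
      by (auto simp: F_def)
  qed simp
  also have "\<dots> = (\<Sum>j=0..card A - card S.
      ((card A - card S) choose j) * Bell (card A - card S - j))"
    using sum_card_Pow[of "A - S" "\<lambda>j. Bell (card A - card S - j)"] assms fS
    by (simp add: card_Diff_subset)
  finally show ?thesis .
qed

text \<open>Prescribing the fiber is a pointwise condition: the color is forced to be
  \<open>a\<close> on \<open>S\<close> and anything but \<open>a\<close> elsewhere. The colorings
  thus form a dependent product.\<close>

lemma card_colorings_with_fiber:
  assumes "finite A" "S \<subseteq> A" "a \<in> C" "finite C"
  shows "card {f \<in> A \<rightarrow>\<^sub>E C. {x \<in> A. f x = a} = S} = (card C - 1) ^ (card A - card S)"
proof -
  have "{f \<in> A \<rightarrow>\<^sub>E C. {x \<in> A. f x = a} = S} = (\<Pi>\<^sub>E x\<in>A. if x \<in> S then {a} else C - {a})"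
    using assms(2,3) by (fastforce simp: PiE_iff split: if_splits)
  also have "card \<dots> = (\<Prod>x\<in>A. if x \<in> S then 1 else card C - 1)"
    using assms by (auto simp: card_PiE intro!: prod.cong)
  also have "\<dots> = (\<Prod>x\<in>A - S. card C - 1)"
    using assms(1) by (intro prod.mono_neutral_cong_right) auto
  finally show ?thesis
    using assms finite_subset[OF assms(2,1)] by (simp add: card_Diff_subset)
qed

text \<open>Under avoidance, the block of any one element colored \<open>a\<close> must contain all
  the others. The empty fiber is listed separately because the partition of an empty
  \<open>A\<close> has no block to serve as \<open>X\<close>.\<close>

lemma not_eq_contains_12_iff:
  assumes "partition_on A P"
  shows "\<not> eq_contains_12 a (P, f) \<longleftrightarrow>
    {x \<in> A. f x = a} = {} \<or> (\<exists>X\<in>P. {x \<in> A. f x = a} \<subseteq> X)" (is "?L \<longleftrightarrow> ?R")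
proof -
  have A: "\<Union>P = A" and dj: "\<And>X Y z. X \<in> P \<Longrightarrow> Y \<in> P \<Longrightarrow> z \<in> X \<Longrightarrow> z \<in> Y \<Longrightarrow> X = Y"
    using assms by (auto simp: partition_on_def disjoint_def)
  have "\<exists>X\<in>P. {x \<in> A. f x = a} \<subseteq> X" if L: ?L and x: "x \<in> A" "f x = a" for x
  proof -
    obtain X where X: "X \<in> P" "x \<in> X" using A x by blast
    have "{x \<in> A. f x = a} \<subseteq> X"
    proof
      fix y assume "y \<in> {x \<in> A. f x = a}"
      then have y: "y \<in> A" "f y = a" by auto
      then obtain Y where Y: "Y \<in> P" "y \<in> Y" using A by blast
      show "y \<in> X"
      \<comment> \<open>The forbidden pair has to be listed in increasing order, so \<open>x\<close>
        and \<open>y\<close> swap roles between the cases.\<close>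
      proof (cases x y rule: linorder_cases)
        case less
        then show ?thesis using L X Y x(2) y(2) unfolding eq_contains_12_def by auto
      next
        case greater
        then show ?thesis using L X Y x(2) y(2) unfolding eq_contains_12_def by auto
      qed (use X in simp)
    qed
    with X show ?thesis by blast
  qed
  moreover have ?L if R: ?R
  proof
    assume "eq_contains_12 a (P, f)"
    then obtain X Y x y where "X \<in> P" "Y \<in> P" "x \<in> X" "y \<in> Y" "X \<noteq> Y" "f x = a" "f y = a"
      unfolding eq_contains_12_def by auto
    moreover from this have "x \<in> A" "y \<in> A" using A by auto
    moreover from calculation R obtain Z where "Z \<in> P" "{x \<in> A. f x = a} \<subseteq> Z" by blast
    ultimately show False using dj[of X Z x] dj[of Y Z y] by blast
  qed
  ultimately show ?thesis by blast
qed

theorem theorem2p3: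
  fixes c n a :: nat
  assumes "c \<ge> 1" and "n \<ge> 1" and "a \<in> {1..c}"
  shows "card (eq_avoiders_12 n c a) =
    Bell n * (c - 1) ^ n +
    (\<Sum>i=1..n. \<Sum>j=0..n - i.
      (n choose i) * ((n - i) choose j) * Bell (n - i - j) * (c - 1) ^ (n - i))"
proof -
  let ?A = "{1..n}"
  define Q where "Q S = {P. partition_on ?A P \<and> (S = {} \<or> (\<exists>X\<in>P. S \<subseteq> X))}" for S
  define K where "K S = {f \<in> ?A \<rightarrow>\<^sub>E {1..c}. {x \<in> ?A. f x = a} = S}" for S
  \<comment> \<open>At \<open>i = 0\<close> every partition qualifies, whereas the sum would give
    the Bell number of \<open>n + 1\<close>: with \<open>S\<close> empty, \<open>T\<close> is no
    longer determined by the partition.\<close>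
  define q where "q i = (if i = 0 then Bell n
    else \<Sum>j=0..n - i. ((n - i) choose j) * Bell (n - i - j))" for i
  have fin: "finite (Q S)" "finite (K S)" for S
    using finite_partitions_on[of ?A] finite_PiE[of ?A "\<lambda>_. {1..c}"]
    by (auto simp: Q_def K_def intro: finite_subset)
  have cQ: "card (Q S) = q (card S)" if "S \<in> Pow ?A" for S
  proof (cases "S = {}")
    case True
    then show ?thesis by (simp add: Q_def q_def Bell_def)
  next
    case False
    then show ?thesis
      using that card_partitions_subset_block[of ?A S] finite_subset[of S ?A]
      by (auto simp: Q_def q_def)
  qed
  have cK: "card (K S) = (c - 1) ^ (n - card S)" if "S \<in> Pow ?A" for S
    using that assms(3) card_colorings_with_fiber[of ?A S a "{1..c}"] by (simp add: K_def)
  have "eq_avoiders_12 n c a = (\<Union>S\<in>Pow ?A. Q S \<times> K S)"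
  proof (rule set_eqI)
    fix \<pi> :: "nat set set \<times> (nat \<Rightarrow> nat)"
    obtain P f where \<pi>: "\<pi> = (P, f)" by fastforce
    let ?S = "{x \<in> ?A. f x = a}"
    \<comment> \<open>Membership of \<open>f\<close> in \<open>K S\<close> forces \<open>S\<close>
      to be the fiber of \<open>f\<close> over \<open>a\<close>, so only this one index of the union
      can contain the pair.\<close>
    have "\<pi> \<in> eq_avoiders_12 n c a \<longleftrightarrow> P \<in> Q ?S \<and> f \<in> K ?S"
      using not_eq_contains_12_iff[of ?A P a f]
      unfolding eq_avoiders_12_def colored_partitions_def Q_def K_def \<pi> by blast
    also have "\<dots> \<longleftrightarrow> \<pi> \<in> (\<Union>S\<in>Pow ?A. Q S \<times> K S)"
      unfolding K_def \<pi> by blast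
    finally show "\<pi> \<in> eq_avoiders_12 n c a \<longleftrightarrow> \<pi> \<in> (\<Union>S\<in>Pow ?A. Q S \<times> K S)" .
  qed
  also have "card \<dots> = (\<Sum>S\<in>Pow ?A. card (Q S \<times> K S))"
    \<comment> \<open>Disjointness comes from the second factors alone: a coloring has just one
      fiber over \<open>a\<close>.\<close>
    by (rule card_UN_disjoint) (use fin in \<open>auto simp: K_def\<close>)
  also have "\<dots> = (\<Sum>S\<in>Pow ?A. q (card S) * (c - 1) ^ (n - card S))"
    by (intro sum.cong refl) (simp only: card_cartesian_product cQ cK)
  also have "\<dots> = (\<Sum>i=0..n. (n choose i) * (q i * (c - 1) ^ (n - i)))"
    using sum_card_Pow[of ?A "\<lambda>i. q i * (c - 1) ^ (n - i)"] by simp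
  \<comment> \<open>The term \<open>i = 0\<close>, where color \<open>a\<close> does not occur, is
    the isolated first summand.\<close>
  also have "\<dots> = Bell n * (c - 1) ^ n + (\<Sum>i=1..n. (n choose i) * (q i * (c - 1) ^ (n - i)))"
    by (simp add: sum.atLeast_Suc_atMost q_def)
  also have "(\<Sum>i=1..n. (n choose i) * (q i * (c - 1) ^ (n - i))) =
    (\<Sum>i=1..n. \<Sum>j=0..n - i.
      (n choose i) * ((n - i) choose j) * Bell (n - i - j) * (c - 1) ^ (n - i))"
    by (intro sum.cong refl) (simp add: q_def sum_distrib_left sum_distrib_right mult.assoc)
  finally show ?thesis .
qed

end
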